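(* Let $\mathcal{X} \subset \mathbb{R}^n$ and $f:\mathcal{X}\rightarrow\mathbb{R}^+$, let $\mathbf{x}^*\in\mathcal{X}$ be an optimal solution of $\min_{\mathbf{x}\in\mathcal{X}} f(\mathbf{x})$, let $\epsilon\geq 0$, and let $\mathcal{X}^\epsilon=\{\mathbf{x}\in\mathcal{X}\mid f(\mathbf{x})\leq(1+\epsilon)f(\mathbf{x}^* )\}$. Let $\mathbf{d}\in\{0,1\}^n$ and let $$\Phi_{\mathbf{d}}=\{\phi_{\mathbf{d}}^{c}\mid c\in\mathbb{R}\},\qquad \phi_{\mathbf{d}}^{c}(\mathbf{x})\coloneqq \mathbf{d}^T\mathbf{x}\geq c\quad(\mathbf{x}\in\mathcal{X}),$$ where $\mathbf{d}^T\mathbf{x}=\sum_{i=1}^n d_ix_i$. Let $c^*=\min_{\mathbf{x}\in\mathcal{X}^\epsilon}\mathbf{d}^T\mathbf{x}$ (the minimum being assumed to be attained). Then $\phi_{\mathbf{d}}^{c^*}$ is the only element of the set of non-implied necessary conditions for $\epsilon$-optimality, i.e. $\overline{\Phi}_{\mathbf{d}}^{\mathcal{X}^\epsilon}=\{\phi_{\mathbf{d}}^{c^*}\}$.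
   Context: A condition is a function $\phi:\mathcal{X}\rightarrow\{0,1\}$. The notation $\phi_{\mathbf{d}}^{c}(\mathbf{x})\coloneqq\mathbf{d}^T\mathbf{x}\geq c$ means that $\phi_{\mathbf{d}}^{c}(\mathbf{x})=1$ if $\mathbf{d}^T\mathbf{x}\geq c$ and $\phi_{\mathbf{d}}^{c}(\mathbf{x})=0$ otherwise. Sets of conditions are sets of functions on $\mathcal{X}$: two conditions are equal exactly when they are equal as functions $\mathcal{X}\to\{0,1\}$ (so different values of $c$ may give the same condition). For a condition $\phi$, let $\mathcal{I}_\phi=\{\mathbf{x}\in\mathcal{X}\mid\phi(\mathbf{x})=1\}$. Two conditions with $\mathcal{I}_{\phi}=\mathcal{I}_{\phi'}$ are equal. For a set of conditions $\Phi$, the set of necessary conditions for $\epsilon$-optimality is $$\Phi^{\mathcal{X}^\epsilon}=\{\phi\in\Phi\mid\forall \mathbf{x}\in\mathcal{X}^\epsilon:\phi(\mathbf{x})=1\},$$ and the set of non-implied necessary conditions for $\epsilon$-optimality is $$\overline{\Phi}^{\mathcal{X}^\epsilon}=\{\phi\in\Phi^{\mathcal{X}^\epsilon}\mid\forall\phi'\in\Phi^{\mathcal{X}^\epsilon}\setminus\{\phi\}:\mathcal{I}_{\phi'}\not\subset\mathcal{I}_{\phi}\}.$$ $\overline{\Phi}_{\mathbf{d}}^{\mathcal{X}^\epsilon}$ denotes this set for $\Phi=\Phi_{\mathbf{d}}$. $\mathbb{R}^+$ denotes the nonnegative reals. *)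

theory Defs
  imports "HOL-Analysis.Analysis"
begin

text \<open>
  A condition is a function from \<open>X\<close> to \<open>{0, 1}\<close>. Such functions are represented extensionally
  (\<open>undefined\<close> outside \<open>X\<close>), so that HOL equality of two conditions is equality as functions on \<open>X\<close>.
\<close>

definition conditions :: "'a set \<Rightarrow> ('a \<Rightarrow> nat) set" where
  "conditions X = X \<rightarrow>\<^sub>E {0, 1}"

definition sat_set :: "'a set \<Rightarrow> ('a \<Rightarrow> nat) \<Rightarrow> 'a set" where
  "sat_set X \<phi> = {x \<in> X. \<phi> x = 1}"

lemma conditions_eqI:
  assumes "\<phi> \<in> conditions X" and "\<phi>' \<in> conditions X" and "sat_set X \<phi> = sat_set X \<phi>'"
  shows "\<phi> = \<phi>'"
proof (rule PiE_ext)
  show "\<phi> \<in> X \<rightarrow>\<^sub>E {0, 1}" and "\<phi>' \<in> X \<rightarrow>\<^sub>E {0, 1}"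
    using assms by (auto simp: conditions_def)
  fix x assume x: "x \<in> X"
  have "\<phi> x \<in> {0, 1}" and "\<phi>' x \<in> {0, 1}"
    using assms(1,2) x by (auto simp: conditions_def PiE_iff)
  moreover have "\<phi> x = 1 \<longleftrightarrow> \<phi>' x = 1"
    using assms(3) x by (auto simp: sat_set_def set_eq_iff)
  ultimately show "\<phi> x = \<phi>' x" by auto
qed

definition near_optimal :: "'a set \<Rightarrow> ('a \<Rightarrow> real) \<Rightarrow> real \<Rightarrow> 'a \<Rightarrow> 'a set" where
  "near_optimal X f \<epsilon> xstar = {x \<in> X. f x \<le> (1 + \<epsilon>) * f xstar}"

definition necessary_conditions :: "('a \<Rightarrow> nat) set \<Rightarrow> 'a set \<Rightarrow> ('a \<Rightarrow> nat) set" where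
  "necessary_conditions \<Phi> Xeps = {\<phi> \<in> \<Phi>. \<forall>x\<in>Xeps. \<phi> x = 1}"

text \<open>
  For sets of conditions it makes no difference whether the inclusion below is strict, by
  \<open>conditions_eqI\<close>.
\<close>

definition nonimplied_necessary_conditions ::
    "'a set \<Rightarrow> ('a \<Rightarrow> nat) set \<Rightarrow> 'a set \<Rightarrow> ('a \<Rightarrow> nat) set" where
  "nonimplied_necessary_conditions X \<Phi> Xeps =
     {\<phi> \<in> necessary_conditions \<Phi> Xeps.
        \<forall>\<phi>' \<in> necessary_conditions \<Phi> Xeps - {\<phi>}. \<not> sat_set X \<phi>' \<subset> sat_set X \<phi>}"

definition threshold_condition ::
    "(real ^ 'n) set \<Rightarrow> real ^ 'n \<Rightarrow> real \<Rightarrow> real ^ 'n \<Rightarrow> nat" where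
  "threshold_condition X d c = (\<lambda>x\<in>X. if d \<bullet> x \<ge> c then 1 else 0)"

definition threshold_conditions ::
    "(real ^ 'n) set \<Rightarrow> real ^ 'n \<Rightarrow> (real ^ 'n \<Rightarrow> nat) set" where
  "threshold_conditions X d = range (threshold_condition X d)"

lemma threshold_conditions_subset: "threshold_conditions X d \<subseteq> conditions X"
  by (auto simp: threshold_conditions_def threshold_condition_def conditions_def split: if_splits)

end

theory Submission
  imports Defs
begin

text \<open>
  For a fixed vector \<open>d\<close> the threshold conditions form a chain under implication: raising \<open>c\<close> can
  only remove points from the set where \<open>d \<bullet> x \<ge> c\<close>. A threshold is valid for all of a set \<open>S\<close>
  exactly when it does not exceed the minimum \<open>cstar\<close> of \<open>d \<bullet> x\<close> over \<open>S\<close>, so \<open>cstar\<close> is the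
  largest necessary threshold and its condition has the smallest satisfaction set of all necessary
  threshold conditions
  (\<open>threshold_condition_necessary_iff\<close> and \<open>sat_set_threshold_antimono\<close>).

  In any family of conditions, a necessary condition with smallest satisfaction set implies every
  other necessary condition. The implication is strict because distinct conditions have distinct
  satisfaction sets, so nothing else survives (\<open>nonimplied_necessary_conditions_eq_least\<close>).
\<close>

text \<open>
  Membership in \<open>conditions X\<close> is what makes the least element unique: without it, distinct
  functions sharing the smallest satisfaction set would all be non-implied.
\<close>

lemma nonimplied_necessary_conditions_eq_least:
  assumes conds: "\<Phi> \<subseteq> conditions X"
    and nec: "\<phi> \<in> necessary_conditions \<Phi> S"
    and least: "\<And>\<psi>. \<psi> \<in> necessary_conditions \<Phi> S \<Longrightarrow> sat_set X \<phi> \<subseteq> sat_set X \<psi>"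
  shows "nonimplied_necessary_conditions X \<Phi> S = {\<phi>}"
proof
  show "{\<phi>} \<subseteq> nonimplied_necessary_conditions X \<Phi> S"
    using nec least unfolding nonimplied_necessary_conditions_def by fast
  show "nonimplied_necessary_conditions X \<Phi> S \<subseteq> {\<phi>}"
  proof
    fix \<psi> assume "\<psi> \<in> nonimplied_necessary_conditions X \<Phi> S"
    then have \<psi>: "\<psi> \<in> necessary_conditions \<Phi> S"
      and nonimplied: "\<And>\<phi>'. \<phi>' \<in> necessary_conditions \<Phi> S \<Longrightarrow> \<phi>' \<noteq> \<psi> \<Longrightarrow>
        \<not> sat_set X \<phi>' \<subset> sat_set X \<psi>"
      unfolding nonimplied_necessary_conditions_def by auto
    show "\<psi> \<in> {\<phi>}"
    proof (rule ccontr)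
      assume "\<psi> \<notin> {\<phi>}"
      then have "sat_set X \<phi> \<noteq> sat_set X \<psi>"
        using conds nec \<psi> conditions_eqI[of \<phi> X \<psi>] unfolding necessary_conditions_def by auto
      with least[OF \<psi>] nonimplied[OF nec] \<open>\<psi> \<notin> {\<phi>}\<close> show False by auto
    qed
  qed
qed

lemma sat_set_threshold_condition:
  "sat_set X (threshold_condition X d c) = {x \<in> X. c \<le> d \<bullet> x}"
  unfolding sat_set_def threshold_condition_def by (auto split: if_splits)

lemma sat_set_threshold_antimono:
  assumes "c \<le> c'"
  shows "sat_set X (threshold_condition X d c') \<subseteq> sat_set X (threshold_condition X d c)"
  using assms by (auto simp: sat_set_threshold_condition)

text \<open>
  A minimiser in \<open>S\<close> violates every threshold above \<open>cstar\<close>, and all of \<open>S\<close> satisfies every other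
  threshold.
\<close>

lemma threshold_condition_necessary_iff:
  assumes "S \<subseteq> X"
    and "\<exists>x\<in>S. d \<bullet> x = cstar"
    and "\<forall>x\<in>S. cstar \<le> d \<bullet> x"
  shows "threshold_condition X d c \<in> necessary_conditions (threshold_conditions X d) S
           \<longleftrightarrow> c \<le> cstar"
proof -
  have "threshold_condition X d c x = 1 \<longleftrightarrow> c \<le> d \<bullet> x" if "x \<in> S" for x
    using assms(1) that unfolding threshold_condition_def by auto
  then have "threshold_condition X d c \<in> necessary_conditions (threshold_conditions X d) S
      \<longleftrightarrow> (\<forall>x\<in>S. c \<le> d \<bullet> x)"
    unfolding necessary_conditions_def threshold_conditions_def by auto
  also have "\<dots> \<longleftrightarrow> c \<le> cstar"
    using assms(2,3) by force
  finally show ?thesis .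
qed

theorem theorem1:
  fixes X :: "(real ^ 'n) set"
    and f :: "real ^ 'n \<Rightarrow> real"
    and xstar d :: "real ^ 'n"
    and \<epsilon> cstar :: real
  assumes "\<forall>x\<in>X. f x \<ge> 0"
    and "xstar \<in> X" and "\<forall>x\<in>X. f xstar \<le> f x"
    and "\<epsilon> \<ge> 0"
    and "\<forall>i. d $ i \<in> {0, 1}"
    and "\<exists>x\<in>near_optimal X f \<epsilon> xstar. d \<bullet> x = cstar"
    and "\<forall>x\<in>near_optimal X f \<epsilon> xstar. cstar \<le> d \<bullet> x"
  shows "nonimplied_necessary_conditions X (threshold_conditions X d) (near_optimal X f \<epsilon> xstar)
           = {threshold_condition X d cstar}"
proof (rule nonimplied_necessary_conditions_eq_least[OF threshold_conditions_subset])
  let ?S = "near_optimal X f \<epsilon> xstar"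
  have "?S \<subseteq> X"
    unfolding near_optimal_def by auto
  note necessary_iff = threshold_condition_necessary_iff[OF this assms(6,7)]
  show "threshold_condition X d cstar \<in> necessary_conditions (threshold_conditions X d) ?S"
    by (simp add: necessary_iff)
  fix \<psi> assume \<psi>: "\<psi> \<in> necessary_conditions (threshold_conditions X d) ?S"
  then obtain c where c: "\<psi> = threshold_condition X d c"
    unfolding necessary_conditions_def threshold_conditions_def by auto
  with \<psi> have "c \<le> cstar"
    by (simp add: necessary_iff)
  then show "sat_set X (threshold_condition X d cstar) \<subseteq> sat_set X \<psi>"
    unfolding c by (rule sat_set_threshold_antimono)
qed

end
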